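(* Let $G$ be an abelian group and let $\phi : \mathbf{Fans}_d \to G$ be a rotation-invariant fan valuation. Then there are $g_0,\dots,g_d \in G$ such that for every hyperplane arrangement $\mathcal{A}$ in a linear subspace of $\mathbb{R}^d$ \[ \phi(\mathcal{N}(\mathcal{A})) \ = \ g_0\, w_0(\mathcal{A}) + \cdots + g_d\, w_d(\mathcal{A}) \, . \] Conversely, for every deletion-restriction invariant $\psi$ on hyperplane arrangements in linear subspaces of $\mathbb{R}^d$ with values in an abelian group $G$, there is a fan valuation $\phi : \mathbf{Fans}_d \to G$ with $\psi(\mathcal{A}) = \phi(\mathcal{N}(\mathcal{A}))$ for every such arrangement $\mathcal{A}$.
   Context: Polyhedral cones are nonempty and contain the origin. For a cone $C$, $\mathrm{lin}(C)$ is its linear hull and $\mathrm{relint}(C)$ its relative interior. A fan in $\mathbb{R}^d$ is a finite collection $\mathcal{N}$ of polyhedral cones in $\mathbb{R}^d$ such that for all $C,C'\in\mathcal{N}$: (i) $C\cap C'$ is a face of $C$, and (ii) $\mathrm{lin}(C)=\mathrm{lin}(C')$; this common linear hull is denoted $\mathrm{lin}(\mathcal{N})$. (The fan need not be complete and only the cones of top dimension are members.) $\mathbf{Fans}_d$ is the set of all fans in $\mathbb{R}^d$, including the empty fan $\emptyset$. For a set $S\subseteq \mathrm{lin}(\mathcal{N})$ put $\mathcal{N}\cap S = \{C\cap S : C\in\mathcal{N},\ \mathrm{relint}(C)\cap S\neq\emptyset\}$. A map $\phi$ from $\mathbf{Fans}_d$ to an abelian group is a fan valuation if $\phi(\emptyset)=0$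 and for every nonempty fan $\mathcal{N}\in\mathbf{Fans}_d$ and every linear hyperplane $H\subseteq\mathrm{lin}(\mathcal{N})$ (i.e. linear subspace of codimension 1 in $\mathrm{lin}(\mathcal{N})$) one has $\phi(\mathcal{N})=\phi(\mathcal{N}\cap H^{\le})+\phi(\mathcal{N}\cap H^{\ge})-\phi(\mathcal{N}\cap H)$, where $H^{\le},H^{\ge}$ are the two closed halfspaces of $\mathrm{lin}(\mathcal{N})$ bounded by $H$. It is rotation-invariant if $\phi(\{gC : C\in\mathcal{N}\})=\phi(\mathcal{N})$ for all $g\in\mathrm{SO}(\mathbb{R}^d)$ and $\mathcal{N}\in\mathbf{Fans}_d$. A hyperplane arrangement $\mathcal{A}$ is a nonempty finite collection of linear hyperplanes in some linear subspace $L\subseteq\mathbb{R}^d$. The closures of the connected components of $L\setminus\bigcup\mathcal{A}$ form a fan $\mathcal{N}(\mathcal{A})$. For $1\le k\le d$, a $k$-singleton is an arrangement consisting of a single hyperplane in a $k$-dimensional linear subspace of $\mathbb{R}^d$; a singleton is a $k$-singleton for some $k$. For $H\in\mathcal{A}$, the deletion is $\mathcal{A}\backslash H=\{H'\in\mathcal{A}:H'\ne H\}$ (an arrangement in $L$) and the restriction is $\mathcal{A}/H=\{H'\cap H : H'\in\mathcal{A},H'\neq H\}$ (an arrangement in $H$). The unsigned characteristic polynomial $\overline{\chi}_{\mathcal{A}}(t)$ is defined recursively by $\overline{\chi}_{\mathcal{A}}(t)=t^k+t^{k-1}$ if $\mathcal{A}$ is a $k$-singleton and $\overline{\chi}_{\mathcal{A}}(t)=\overline{\chi}_{\mathcal{A}\backslash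 H}(t)+\overline{\chi}_{\mathcal{A}/H}(t)$ for $H\in\mathcal{A}$ if $\mathcal{A}$ has more than one hyperplane; it is related to the usual characteristic polynomial by $\overline{\chi}_{\mathcal{A}}(t)=(-1)^{\dim L}\chi_{\mathcal{A}}(-t)$. The (unsigned) Whitney number of the first kind $w_i(\mathcal{A})$ is the coefficient of $t^i$ in $\overline{\chi}_{\mathcal{A}}(t)$. A deletion-restriction invariant is a map $\psi$ from the hyperplane arrangements in linear subspaces of $\mathbb{R}^d$ to an abelian group $G$ that takes, for each $k$, the same value on all $k$-singletons, and satisfies $\psi(\mathcal{A})=\psi(\mathcal{A}\backslash H)+\psi(\mathcal{A}/H)$ for every $\mathcal{A}$ that is not a singleton and every $H\in\mathcal{A}$ (no special treatment of coloops). *)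

theory Defs
  imports "HOL-Analysis.Analysis" "HOL-Computational_Algebra.Polynomial"
begin

section \<open>Fans and fan valuations\<close>

definition polyhedral_cone :: "'a::euclidean_space set \<Rightarrow> bool" where
  "polyhedral_cone C \<longleftrightarrow> C \<noteq> {} \<and> polyhedron C \<and> cone C"

definition fan :: "'a::euclidean_space set set \<Rightarrow> bool" where
  "fan N \<longleftrightarrow> finite N \<and> (\<forall>C\<in>N. polyhedral_cone C) \<and>
     (\<forall>C\<in>N. \<forall>C'\<in>N. (C \<inter> C') face_of C \<and> span C = span C')"

text \<open>The common linear hull of the cones of a nonempty fan, see \<open>lin_fan_eq\<close>.\<close>

definition lin_fan :: "'a::euclidean_space set set \<Rightarrow> 'a set" where
  "lin_fan N = span (\<Union>N)"

lemma lin_fan_eq: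
  assumes "fan N" "C \<in> N"
  shows "lin_fan N = span C"
proof
  have "\<Union>N \<subseteq> span C"
    using assms unfolding fan_def by (metis Sup_least span_superset)
  then show "lin_fan N \<subseteq> span C"
    unfolding lin_fan_def by (simp add: span_minimal)
  show "span C \<subseteq> lin_fan N"
    unfolding lin_fan_def using assms(2) by (intro span_mono) blast
qed

definition fan_cut :: "'a::euclidean_space set set \<Rightarrow> 'a set \<Rightarrow> 'a set set" where
  "fan_cut N S = {C \<inter> S | C. C \<in> N \<and> rel_interior C \<inter> S \<noteq> {}}"

definition linear_hyperplane :: "'a::euclidean_space set \<Rightarrow> 'a set \<Rightarrow> bool" where
  "linear_hyperplane L H \<longleftrightarrow> subspace H \<and> H \<subseteq> L \<and> dim L = dim H + 1"

text \<open>
  The halfspaces of \<open>lin_fan N\<close> bounded by \<open>H\<close> are given by any vector \<open>a\<close> that cuts out \<open>H\<close>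
  in \<open>lin_fan N\<close>. Such an \<open>a\<close> exists by \<open>linear_hyperplane_normal\<close>; it is nonzero on
  \<open>lin_fan N\<close> since \<open>H\<close> is a proper subspace, and it is determined there up to a nonzero factor,
  so the unordered pair of halfspaces depends only on \<open>H\<close>.
\<close>

definition fan_valuation :: "('a::euclidean_space set set \<Rightarrow> 'g::ab_group_add) \<Rightarrow> bool" where
  "fan_valuation \<phi> \<longleftrightarrow> \<phi> {} = 0 \<and>
     (\<forall>N H a. fan N \<and> N \<noteq> {} \<and> linear_hyperplane (lin_fan N) H \<and>
        H = {x \<in> lin_fan N. a \<bullet> x = 0} \<longrightarrow>
        \<phi> N = \<phi> (fan_cut N {x \<in> lin_fan N. a \<bullet> x \<le> 0})
             + \<phi> (fan_cut N {x \<in> lin_fan N. a \<bullet> x \<ge> 0})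
             - \<phi> (fan_cut N H))"

lemma linear_hyperplane_normal:
  fixes L :: "'a::euclidean_space set"
  assumes L: "subspace L" and H: "linear_hyperplane L H"
  shows "\<exists>a. H = {x \<in> L. a \<bullet> x = 0}"
proof -
  have sH: "subspace H" and HL: "H \<subseteq> L" and d: "dim L = dim H + 1"
    using H by (auto simp: linear_hyperplane_def)
  have "span H \<subset> span L"
    using sH HL L d by (metis add_eq_self_zero one_neq_zero psubsetI span_eq_iff)
  then obtain a where a: "a \<noteq> 0" "a \<in> span L" "\<And>y. y \<in> span H \<Longrightarrow> orthogonal a y"
    using orthogonal_to_subspace_exists_gen by blast
  let ?K = "{x \<in> L. a \<bullet> x = 0}"
  have sK: "subspace ?K"
    using subspace_inter[OF L subspace_hyperplane[of a]] by (simp add: Int_def)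
  have HK: "H \<subseteq> ?K"
    using a(3) HL by (auto simp: orthogonal_def span_base)
  have "a \<in> L" "a \<notin> ?K"
    using a L by (auto simp: span_eq_iff[THEN iffD2])
  then have "?K \<subset> L"
    by blast
  then have "dim ?K < dim L"
    using sK L by (metis dim_psubset span_eq_iff)
  then have "H = ?K"
    using d subspace_dim_equal[OF sH sK HK] by simp
  then show ?thesis ..
qed

definition rotation_invariant :: "((real^'n) set set \<Rightarrow> 'g) \<Rightarrow> bool" where
  "rotation_invariant \<phi> \<longleftrightarrow>
     (\<forall>Q N. rotation_matrix Q \<and> fan N \<longrightarrow> \<phi> ((\<lambda>C. (*v) Q ` C) ` N) = \<phi> N)"


section \<open>Hyperplane arrangements\<close>

text \<open>
  An arrangement is a pair of an ambient subspace \<open>L\<close> and a set \<open>A\<close> of hyperplanes of \<open>L\<close>: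
  if \<open>A\<close> has only one element, then \<open>L\<close> cannot be recovered from \<open>A\<close>.
\<close>

definition arrangement :: "'a::euclidean_space set \<Rightarrow> 'a set set \<Rightarrow> bool" where
  "arrangement L A \<longleftrightarrow>
     subspace L \<and> finite A \<and> A \<noteq> {} \<and> (\<forall>H\<in>A. linear_hyperplane L H)"

definition arrangement_fan :: "'a::euclidean_space set \<Rightarrow> 'a set set \<Rightarrow> 'a set set" where
  "arrangement_fan L A = closure ` components (L - \<Union>A)"

definition deletion :: "'a set set \<Rightarrow> 'a set \<Rightarrow> 'a set set" where
  "deletion A H = {H' \<in> A. H' \<noteq> H}"

definition restriction :: "'a set set \<Rightarrow> 'a set \<Rightarrow> 'a set set" where
  "restriction A H = {H' \<inter> H | H'. H' \<in> A \<and> H' \<noteq> H}"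

definition singleton_arrangement ::
    "nat \<Rightarrow> 'a::euclidean_space set \<Rightarrow> 'a set set \<Rightarrow> bool" where
  "singleton_arrangement k L A \<longleftrightarrow> arrangement L A \<and> is_singleton A \<and> dim L = k"

text \<open>
  \<open>unsigned_char_poly_rel L A p\<close>: \<open>p\<close> is a value computed for the arrangement \<open>A\<close> in \<open>L\<close> by
  the deletion-restriction recursion, for some choice of hyperplanes along the way. It is a
  standard fact that the choices do not matter, so that \<open>p\<close> is unique.
\<close>

inductive unsigned_char_poly_rel ::
    "'a::euclidean_space set \<Rightarrow> 'a set set \<Rightarrow> nat poly \<Rightarrow> bool" where
  singleton: "singleton_arrangement k L A \<Longrightarrow>
    unsigned_char_poly_rel L A (monom 1 k + monom 1 (k - 1))"
| deletion_restriction: "\<lbrakk>arrangement L A; \<not> is_singleton A; H \<in> A;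
    unsigned_char_poly_rel L (deletion A H) p;
    unsigned_char_poly_rel H (restriction A H) q\<rbrakk> \<Longrightarrow>
    unsigned_char_poly_rel L A (p + q)"

definition unsigned_char_poly :: "'a::euclidean_space set \<Rightarrow> 'a set set \<Rightarrow> nat poly" where
  "unsigned_char_poly L A = (THE p. unsigned_char_poly_rel L A p)"

definition whitney_number :: "nat \<Rightarrow> 'a::euclidean_space set \<Rightarrow> 'a set set \<Rightarrow> nat" where
  "whitney_number i L A = coeff (unsigned_char_poly L A) i"

definition deletion_restriction_invariant ::
    "('a::euclidean_space set \<Rightarrow> 'a set set \<Rightarrow> 'g::ab_group_add) \<Rightarrow> bool" where
  "deletion_restriction_invariant \<psi> \<longleftrightarrow>
     (\<forall>k L A L' A'. singleton_arrangement k L A \<and> singleton_arrangement k L' A' \<longrightarrow>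
        \<psi> L A = \<psi> L' A') \<and>
     (\<forall>L A H. arrangement L A \<and> \<not> is_singleton A \<and> H \<in> A \<longrightarrow>
        \<psi> L A = \<psi> L (deletion A H) + \<psi> H (restriction A H))"

definition nat_multiple :: "nat \<Rightarrow> 'g::ab_group_add \<Rightarrow> 'g" where
  "nat_multiple n g = (\<Sum>_<n. g)"

end

theory Submission
  imports Defs
begin

text \<open>
  The bridge between the two notions is the fan \<open>{L}\<close> with the single cone \<open>L\<close>, which is the fan of
  the arrangement in \<open>L\<close> without hyperplanes. Cutting the fan of an arrangement and the fan of its
  deletion along the same hyperplane \<open>H\<close> gives the same fans in the two halfspaces; inside \<open>H\<close> the
  first fan leaves nothing, and the second one leaves the fan of the restriction. So every fan
  valuation \<open>\<phi>\<close> satisfies the deletion-restriction rule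
  (\<open>fan_valuation_arrangement_fan_insert\<close>), down to arrangements without hyperplanes. If in addition
  \<open>\<phi> {L} = g (dim L)\<close> for all subspaces \<open>L\<close>, then \<open>\<phi>\<close> takes the value \<open>g k + g (k - 1)\<close> on
  \<open>k\<close>-singletons and thus the value \<open>\<Sum>i. w\<^sub>i g i\<close> on an arrangement with Whitney numbers \<open>w\<^sub>i\<close>,
  because both sides obey the recursion of the characteristic polynomial
  (\<open>fan_valuation_eq_char_poly_sum\<close>). A rotation-invariant \<open>\<phi>\<close> has this property, since the rotations
  act transitively on subspaces of a given dimension (\<open>rotation_invariant_on_subspaces\<close>).

  Conversely, for every function \<open>g\<close> from the natural numbers to an abelian group there is a fan
  valuation with \<open>\<phi> {L} = g (dim L)\<close> (\<open>fan_valuation_with_values_on_subspaces\<close>). It is built from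
  predicates on cones. For a convex set \<open>E\<close>, whether a convex set \<open>C\<close> meets \<open>E\<close> is a valuation in \<open>C\<close>:
  if \<open>C\<close> meets \<open>E\<close> on both sides of a hyperplane, then it also meets \<open>E\<close> on the hyperplane. For an
  open halfspace \<open>E\<close> of a generic subspace of codimension \<open>j\<close>, a linear subspace \<open>L\<close> meets \<open>E\<close> if and
  only if \<open>j < dim L\<close>. In general no \<open>E\<close> works for all \<open>L\<close> at once, but there are such \<open>E\<close> for finitely
  many \<open>L\<close>, and an ultrafilter limit extends this to all of them
  (\<open>cut_compatible_generic_meet\<close>). Every \<open>g\<close> is a combination of the functions that are \<open>1\<close> on the
  dimensions above \<open>j\<close> and \<open>0\<close> elsewhere, and of the constant one, with coefficients in the group.

  Integer-valued valuations of this kind read off the coefficients of the characteristic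
  polynomial, so they show that the recursion for it does not depend on choices. Given a
  deletion-restriction invariant with value \<open>c k\<close> on \<open>k\<close>-singletons, the equations
  \<open>g k + g (k - 1) = c k\<close> are solvable, and the fan valuation belonging to \<open>g\<close> agrees with the invariant
  by deletion and restriction.
\<close>

section \<open>Chambers of an arrangement given by normals\<close>

definition hyperplane_in :: "'a::euclidean_space set \<Rightarrow> 'a \<Rightarrow> 'a set" where
  "hyperplane_in L v = {x \<in> L. v \<bullet> x = 0}"

text \<open>
  The arrangement is given by a set \<open>V\<close> of normals. Different normals may define the same
  hyperplane, so that restriction to a hyperplane simply keeps the normals, and \<open>V\<close> may be empty.
\<close>
definition generic_points :: "'a::euclidean_space set \<Rightarrow> 'a set \<Rightarrow> 'a set" where
  "generic_points L V = {x \<in> L. \<forall>v\<in>V. v \<bullet> x \<noteq> 0}"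

definition open_chamber :: "'a::euclidean_space set \<Rightarrow> 'a set \<Rightarrow> 'a \<Rightarrow> 'a set" where
  "open_chamber L V x = {y \<in> L. \<forall>v\<in>V. 0 < (v \<bullet> x) * (v \<bullet> y)}"

text \<open>
  The closed chamber of \<open>x\<close>, for \<open>x\<close> outside of all hyperplanes: no hyperplane
  of the arrangement strictly separates a point of it from \<open>x\<close>.
\<close>
definition chamber :: "'a::euclidean_space set \<Rightarrow> 'a set \<Rightarrow> 'a \<Rightarrow> 'a set" where
  "chamber L V x = {y \<in> L. \<forall>v\<in>V. 0 \<le> (v \<bullet> x) * (v \<bullet> y)}"

definition chambers :: "'a::euclidean_space set \<Rightarrow> 'a set \<Rightarrow> 'a set set" where
  "chambers L V = chamber L V ` generic_points L V"

lemma same_side_perturbation: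
  assumes "finite V" and "\<forall>v\<in>V. v \<bullet> x \<noteq> 0"
  shows "\<exists>e>0. \<forall>v\<in>V. 0 < (v \<bullet> x) * (v \<bullet> (x + e *\<^sub>R w))"
proof -
  have "\<forall>v\<in>V. \<forall>\<^sub>F e in at_right 0. 0 < (v \<bullet> x) * (v \<bullet> (x + e *\<^sub>R w))"
  proof
    fix v assume v: "v \<in> V"
    have "((\<lambda>e. (v \<bullet> x) * (v \<bullet> (x + e *\<^sub>R w))) \<longlongrightarrow> (v \<bullet> x) * (v \<bullet> (x + 0 *\<^sub>R w))) (at_right 0)"
      by (intro tendsto_intros)
    moreover have "0 < (v \<bullet> x) * (v \<bullet> (x + 0 *\<^sub>R w))"
      using assms(2) v by (auto simp: zero_less_mult_iff not_less order_le_less)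
    ultimately show "\<forall>\<^sub>F e in at_right 0. 0 < (v \<bullet> x) * (v \<bullet> (x + e *\<^sub>R w))"
      by (rule order_tendstoD)
  qed
  then have "\<forall>\<^sub>F e in at_right 0. \<forall>v\<in>V. 0 < (v \<bullet> x) * (v \<bullet> (x + e *\<^sub>R w))"
    using assms(1) by (rule eventually_ball_finite[rotated])
  then have "\<forall>\<^sub>F e in at_right (0::real). 0 < e \<and> (\<forall>v\<in>V. 0 < (v \<bullet> x) * (v \<bullet> (x + e *\<^sub>R w)))"
    using eventually_at_right_less[of 0] by eventually_elim auto
  then show ?thesis
    by (rule eventually_happens'[rotated]) simp
qed

text \<open>
  The hyperplanes are added one at a time: a point that lies on the new one is moved off it, by so
  little that it stays off the others.
\<close>
lemma generic_points_nonempty: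
  assumes "finite V" and L: "subspace L" and "\<forall>v\<in>V. \<exists>y\<in>L. v \<bullet> y \<noteq> 0"
  shows "generic_points L V \<noteq> {}"
  using assms(1,3)
proof (induction V)
  case empty
  then show ?case
    using subspace_0[OF L] by (auto simp: generic_points_def)
next
  case (insert v V)
  then obtain x where x: "x \<in> L" "\<forall>u\<in>V. u \<bullet> x \<noteq> 0"
    by (auto simp: generic_points_def)
  obtain y where y: "y \<in> L" "v \<bullet> y \<noteq> 0"
    using insert.prems by auto
  show ?case
  proof (cases "v \<bullet> x = 0")
    case False
    then show ?thesis
      using x by (auto simp: generic_points_def)
  next
    case True
    obtain e where e: "e > 0" "\<forall>u\<in>V. 0 < (u \<bullet> x) * (u \<bullet> (x + e *\<^sub>R y))"
      using same_side_perturbation[OF insert.hyps(1) x(2)] by blast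
    then have "u \<bullet> (x + e *\<^sub>R y) \<noteq> 0" if "u \<in> V" for u
      using that by fastforce
    moreover have "v \<bullet> (x + e *\<^sub>R y) \<noteq> 0"
      using True y(2) e(1) by (simp add: inner_right_distrib)
    moreover have "x + e *\<^sub>R y \<in> L"
      using L x(1) y(1) by (simp add: subspace_add subspace_scale)
    ultimately show ?thesis
      by (auto simp: generic_points_def)
  qed
qed

lemma open_chamber_self: "x \<in> generic_points L V \<Longrightarrow> x \<in> open_chamber L V x"
  by (auto simp: generic_points_def open_chamber_def zero_less_mult_iff not_less order_le_less)

lemma open_chamber_generic: "y \<in> open_chamber L V x \<Longrightarrow> y \<in> generic_points L V"
  by (fastforce simp: generic_points_def open_chamber_def)

lemma chamber_eqI:
  assumes "y \<in> open_chamber L V x"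
  shows "chamber L V y = chamber L V x"
proof -
  have "0 \<le> (v \<bullet> x) * (v \<bullet> z) \<longleftrightarrow> 0 \<le> (v \<bullet> y) * (v \<bullet> z)" if "v \<in> V" for v z
    using assms that by (auto simp: open_chamber_def zero_less_mult_iff zero_le_mult_iff)
  then show ?thesis
    by (auto simp: chamber_def)
qed

lemma chamber_as_Int:
  "chamber L V x = L \<inter> (\<Inter>v\<in>V. {y. ((v \<bullet> x) *\<^sub>R v) \<bullet> y \<ge> 0})"
  by (auto simp: chamber_def)

lemma open_chamber_as_Int:
  "open_chamber L V x = L \<inter> (\<Inter>v\<in>V. {y. ((v \<bullet> x) *\<^sub>R v) \<bullet> y > 0})"
  by (auto simp: open_chamber_def)

lemma convex_open_chamber: "subspace L \<Longrightarrow> convex (open_chamber L V x)"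
  unfolding open_chamber_as_Int
  by (intro convex_Int convex_INT subspace_imp_convex convex_halfspace_gt)

lemma openin_open_chamber:
  assumes "finite V"
  shows "openin (top_of_set L) (open_chamber L V x)"
  unfolding open_chamber_as_Int
  using assms by (intro openin_open_Int open_INT ballI open_halfspace_gt)

lemma closure_open_chamber:
  assumes L: "subspace L" and x: "x \<in> generic_points L V"
  shows "closure (open_chamber L V x) = chamber L V x"
proof
  have "closed (chamber L V x)"
    unfolding chamber_as_Int
    by (intro closed_Int closed_INT ballI closed_subspace L closed_halfspace_ge)
  moreover have "open_chamber L V x \<subseteq> chamber L V x"
    by (auto simp: open_chamber_def chamber_def less_imp_le)
  ultimately show "closure (open_chamber L V x) \<subseteq> chamber L V x"
    by (rule closure_minimal[rotated])
  show "chamber L V x \<subseteq> closure (open_chamber L V x)"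
  proof
    fix y assume y: "y \<in> chamber L V x"
    have "\<forall>\<^sub>F e in at_right 0. y + e *\<^sub>R x \<in> open_chamber L V x"
      using eventually_at_right_less[of 0]
    proof eventually_elim
      case (elim e)
      have xL: "x \<in> L" and yL: "y \<in> L"
        using x y by (auto simp: generic_points_def chamber_def)
      have "0 < (v \<bullet> x) * (v \<bullet> (y + e *\<^sub>R x))" if "v \<in> V" for v
      proof -
        have "0 \<le> (v \<bullet> x) * (v \<bullet> y)"
          using y that by (auto simp: chamber_def)
        moreover have "0 < e * (v \<bullet> x)\<^sup>2"
          using x that elim by (auto simp: generic_points_def)
        ultimately show ?thesis
          by (simp add: inner_right_distrib algebra_simps power2_eq_square)
      qed
      then show ?case
        using L xL yL by (simp add: open_chamber_def subspace_add subspace_scale)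
    qed
    moreover have "((\<lambda>e. y + e *\<^sub>R x) \<longlongrightarrow> y + 0 *\<^sub>R x) (at_right 0)"
      by (intro tendsto_intros)
    then have "((\<lambda>e. y + e *\<^sub>R x) \<longlongrightarrow> y) (at_right 0)"
      by simp
    ultimately show "y \<in> closure (open_chamber L V x)"
      by (intro Lim_in_closed_set[of _ "\<lambda>e. y + e *\<^sub>R x" "at_right (0::real)"])
         (auto elim: eventually_mono intro: closure_subset[THEN subsetD])
  qed
qed

text \<open>
  The open chambers are convex, and a connected set on which a linear form vanishes nowhere lies
  on one side of it; so the open chambers are the connected components of the complement.
\<close>
lemma arrangement_fan_eq_chambers:
  assumes L: "subspace L"
  shows "arrangement_fan L (hyperplane_in L ` V) = chambers L V"
proof -
  have G: "L - \<Union>(hyperplane_in L ` V) = generic_points L V"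
    by (auto simp: hyperplane_in_def generic_points_def)
  have comp: "connected_component_set (generic_points L V) x = open_chamber L V x"
    if x: "x \<in> generic_points L V" for x
  proof
    show "open_chamber L V x \<subseteq> connected_component_set (generic_points L V) x"
      using x open_chamber_self open_chamber_generic convex_open_chamber[OF L]
      by (intro connected_component_maximal convex_connected) blast+
    show "connected_component_set (generic_points L V) x \<subseteq> open_chamber L V x"
    proof
      fix y assume "y \<in> connected_component_set (generic_points L V) x"
      then obtain T where T: "connected T" "T \<subseteq> generic_points L V" "x \<in> T" "y \<in> T"
        by (auto simp: connected_component_def)
      have "0 < (v \<bullet> x) * (v \<bullet> y)" if v: "v \<in> V" for v
      proof (rule ccontr)
        assume "\<not> 0 < (v \<bullet> x) * (v \<bullet> y)"
        then have "(v \<bullet> x \<le> 0 \<and> 0 \<le> v \<bullet> y) \<or> (v \<bullet> y \<le> 0 \<and> 0 \<le> v \<bullet> x)"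
          by (auto simp: zero_less_mult_iff)
        then obtain z where "z \<in> T" "v \<bullet> z = 0"
          using connected_ivt_hyperplane[OF T(1)] T(3,4) by metis
        then show False
          using T(2) v by (auto simp: generic_points_def)
      qed
      then show "y \<in> open_chamber L V x"
        using T by (auto simp: open_chamber_def generic_points_def)
    qed
  qed
  show ?thesis
    unfolding arrangement_fan_def G components_def chambers_def image_image
    by (intro image_cong refl) (simp add: comp closure_open_chamber[OF L])
qed

lemma affine_hull_open_chamber:
  assumes "subspace L" "finite V" "x \<in> generic_points L V"
  shows "affine hull (open_chamber L V x) = L"
proof -
  have L: "affine hull L = L"
    using assms(1) by (simp add: subspace_imp_affine affine_hull_eq)
  have "affine hull (open_chamber L V x) = affine hull L"
    using open_chamber_self[OF assms(3)] openin_open_chamber[OF assms(2), of L]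
    by (intro affine_hull_openin) (auto simp: L)
  then show ?thesis
    by (simp add: L)
qed

lemma rel_interior_chamber:
  assumes L: "subspace L" and V: "finite V" and x: "x \<in> generic_points L V"
  shows "rel_interior (chamber L V x) = open_chamber L V x"
proof -
  have "rel_interior (chamber L V x) = rel_interior (open_chamber L V x)"
    using convex_rel_interior_closure[OF convex_open_chamber[OF L]] closure_open_chamber[OF L x]
    by metis
  also have "\<dots> = open_chamber L V x"
    using affine_hull_open_chamber[OF assms] openin_open_chamber[OF V]
    by (intro rel_interior_openin) simp
  finally show ?thesis .
qed

lemma span_chamber:
  assumes L: "subspace L" and V: "finite V" and x: "x \<in> generic_points L V"
  shows "span (chamber L V x) = L"
proof
  show "span (chamber L V x) \<subseteq> L"
    using L by (intro span_minimal) (auto simp: chamber_def)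
  have "L \<subseteq> span (open_chamber L V x)"
    using affine_hull_open_chamber[OF assms] affine_hull_subset_span by metis
  also have "\<dots> \<subseteq> span (chamber L V x)"
    by (intro span_mono) (auto simp: open_chamber_def chamber_def less_imp_le)
  finally show "L \<subseteq> span (chamber L V x)" .
qed

lemma polyhedral_cone_chamber:
  assumes L: "subspace L" and V: "finite V"
  shows "polyhedral_cone (chamber L V x)"
  unfolding polyhedral_cone_def
proof (intro conjI)
  show "chamber L V x \<noteq> {}"
    using subspace_0[OF L] by (auto simp: chamber_def)
  have "polyhedron L"
    using L by (intro affine_imp_polyhedron subspace_imp_affine)
  moreover have "polyhedron (\<Inter>v\<in>V. {y. ((v \<bullet> x) *\<^sub>R v) \<bullet> y \<ge> 0})"
    using V by (intro polyhedron_Inter) (auto simp del: inner_scaleR_left intro: polyhedron_halfspace_ge)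
  ultimately show "polyhedron (chamber L V x)"
    unfolding chamber_as_Int by (rule polyhedron_Int)
  show "cone (chamber L V x)"
    using L by (auto simp: cone_def chamber_def subspace_scale mult.left_commute)
qed

lemma chamber_Int_face_of:
  assumes L: "subspace L" and V: "finite V" and x: "x \<in> generic_points L V"
  shows "(chamber L V x \<inter> chamber L V x') face_of chamber L V x"
  unfolding face_of_def
proof (intro conjI ballI impI)
  show "chamber L V x \<inter> chamber L V x' \<subseteq> chamber L V x"
    by blast
  show "convex (chamber L V x \<inter> chamber L V x')"
    using polyhedral_cone_chamber[OF L V]
    by (intro convex_Int) (auto simp: polyhedral_cone_def polyhedron_imp_convex)
  fix p q z
  assume p: "p \<in> chamber L V x" and q: "q \<in> chamber L V x"
    and z: "z \<in> chamber L V x \<inter> chamber L V x'" and seg: "z \<in> open_segment p q"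
  obtain u where u: "0 < u" "u < 1" "z = (1 - u) *\<^sub>R p + u *\<^sub>R q"
    using seg by (auto simp: in_segment)
  \<comment> \<open>If \<open>x\<close> and \<open>x'\<close> lie on different sides of a hyperplane, then \<open>z\<close> lies on it, hence so do
    \<open>p\<close> and \<open>q\<close>, which are on the same side.\<close>
  have "0 \<le> (v \<bullet> x') * (v \<bullet> p) \<and> 0 \<le> (v \<bullet> x') * (v \<bullet> q)" if v: "v \<in> V" for v
  proof (cases "0 \<le> (v \<bullet> x) * (v \<bullet> x')")
    case True
    then show ?thesis
      using p q v x by (auto simp: chamber_def generic_points_def zero_le_mult_iff)
  next
    case False
    have "v \<bullet> z = 0"
      using z v False unfolding chamber_def zero_le_mult_iff by force
    moreover have "(1 - u) * ((v \<bullet> x) * (v \<bullet> p)) + u * ((v \<bullet> x) * (v \<bullet> q)) = (v \<bullet> x) * (v \<bullet> z)"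
      by (simp only: u(3) inner_add_right inner_scaleR_right) (simp add: algebra_simps)
    ultimately have "(1 - u) * ((v \<bullet> x) * (v \<bullet> p)) + u * ((v \<bullet> x) * (v \<bullet> q)) = 0"
      by simp
    moreover have "0 \<le> (1 - u) * ((v \<bullet> x) * (v \<bullet> p))" "0 \<le> u * ((v \<bullet> x) * (v \<bullet> q))"
      using p q v u by (auto simp: chamber_def intro!: mult_nonneg_nonneg)
    ultimately have "(1 - u) * ((v \<bullet> x) * (v \<bullet> p)) = 0" "u * ((v \<bullet> x) * (v \<bullet> q)) = 0"
      by linarith+
    then have "v \<bullet> p = 0" "v \<bullet> q = 0"
      using u x v by (auto simp: generic_points_def)
    then show ?thesis
      by simp
  qed
  then show "p \<in> chamber L V x \<inter> chamber L V x'" "q \<in> chamber L V x \<inter> chamber L V x'"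
    using p q by (auto simp: chamber_def)
qed

lemma finite_chambers:
  assumes "finite V"
  shows "finite (chambers L V)"
proof -
  \<comment> \<open>A chamber is determined by the set of normals that are positive on it.\<close>
  let ?g = "\<lambda>P. {y \<in> L. (\<forall>v\<in>P. 0 \<le> v \<bullet> y) \<and> (\<forall>v\<in>V - P. v \<bullet> y \<le> 0)}"
  have "chamber L V x = ?g {v \<in> V. 0 < v \<bullet> x}" if "x \<in> generic_points L V" for x
  proof -
    have "0 \<le> (v \<bullet> x) * (v \<bullet> y) \<longleftrightarrow> (if 0 < v \<bullet> x then 0 \<le> v \<bullet> y else v \<bullet> y \<le> 0)"
      if "v \<in> V" for v y
      using that \<open>x \<in> generic_points L V\<close> by (auto simp: generic_points_def zero_le_mult_iff)
    then show ?thesis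
      by (auto simp: chamber_def)
  qed
  then have "chambers L V \<subseteq> ?g ` Pow V"
    unfolding chambers_def by blast
  then show ?thesis
    using assms finite_subset by blast
qed

lemma fan_chambers:
  assumes L: "subspace L" and V: "finite V"
  shows "fan (chambers L V)"
  unfolding fan_def
proof (intro conjI ballI)
  show "finite (chambers L V)"
    using V by (rule finite_chambers)
  show "polyhedral_cone C" if "C \<in> chambers L V" for C
    using that polyhedral_cone_chamber[OF L V] by (auto simp: chambers_def)
  fix C C' assume C: "C \<in> chambers L V" "C' \<in> chambers L V"
  then show "(C \<inter> C') face_of C" "span C = span C'"
    using chamber_Int_face_of[OF L V] span_chamber[OF L V] by (auto simp: chambers_def)
qed

lemma lin_fan_chambers:
  assumes "subspace L" "finite V" "chambers L V \<noteq> {}"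
  shows "lin_fan (chambers L V) = L"
  using assms lin_fan_eq[OF fan_chambers] span_chamber by (fastforce simp: chambers_def)

section \<open>Cutting chamber fans along a hyperplane\<close>

text \<open>
  If the interior of a chamber meets \<open>S\<close>, then the point naming the chamber can be chosen
  in \<open>S\<close>. This reduces equalities between cut fans to equalities between single cones.
\<close>
lemma fan_cut_chambers:
  assumes L: "subspace L" and V: "finite V" and S: "S \<subseteq> L"
  shows "fan_cut (chambers L V) S = (\<lambda>x. chamber L V x \<inter> S) ` (generic_points L V \<inter> S)"
proof (intro equalityI subsetI)
  fix D assume "D \<in> fan_cut (chambers L V) S"
  then obtain x where x: "x \<in> generic_points L V" "D = chamber L V x \<inter> S"
      "rel_interior (chamber L V x) \<inter> S \<noteq> {}"
    by (auto simp: fan_cut_def chambers_def)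
  then obtain y where "y \<in> open_chamber L V x" "y \<in> S"
    using rel_interior_chamber[OF L V x(1)] by auto
  then show "D \<in> (\<lambda>x. chamber L V x \<inter> S) ` (generic_points L V \<inter> S)"
    using x chamber_eqI open_chamber_generic by blast
next
  fix D assume "D \<in> (\<lambda>x. chamber L V x \<inter> S) ` (generic_points L V \<inter> S)"
  then obtain x where x: "x \<in> generic_points L V" "x \<in> S" "D = chamber L V x \<inter> S"
    by auto
  moreover have "x \<in> rel_interior (chamber L V x)"
    using x open_chamber_self rel_interior_chamber[OF L V] by blast
  ultimately show "D \<in> fan_cut (chambers L V) S"
    unfolding fan_cut_def chambers_def by blast
qed

lemma fan_cut_chambers_hyperplane:
  assumes "subspace L" "finite V"
  shows "fan_cut (chambers L V) (hyperplane_in L a) = chambers (hyperplane_in L a) V"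
proof -
  have "generic_points L V \<inter> hyperplane_in L a = generic_points (hyperplane_in L a) V"
    and "chamber L V x \<inter> hyperplane_in L a = chamber (hyperplane_in L a) V x" for x
    by (auto simp: generic_points_def hyperplane_in_def chamber_def)
  then show ?thesis
    by (subst fan_cut_chambers[OF assms]) (auto simp: chambers_def hyperplane_in_def)
qed

text \<open>
  No chamber of an arrangement has an interior point on a hyperplane of the arrangement.
\<close>
lemma fan_cut_chambers_insert_hyperplane:
  assumes "subspace L" "finite V"
  shows "fan_cut (chambers L (insert a V)) (hyperplane_in L a) = {}"
  using assms by (subst fan_cut_chambers) (auto simp: generic_points_def hyperplane_in_def)

text \<open>
  The chambers of the larger arrangement are those of the smaller one, some of them cut into two
  by the new hyperplane; inside one of its halfspaces the difference disappears.
\<close>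
lemma fan_cut_chambers_insert_halfspace:
  assumes L: "subspace L" and V: "finite V" and a: "\<exists>y\<in>L. a \<bullet> y \<noteq> 0"
  shows "fan_cut (chambers L (insert a V)) {x \<in> L. a \<bullet> x \<le> 0} =
    fan_cut (chambers L V) {x \<in> L. a \<bullet> x \<le> 0}" (is "fan_cut _ ?S = _")
proof -
  have eq: "chamber L (insert a V) x \<inter> ?S = chamber L V x \<inter> ?S" if "a \<bullet> x < 0" for x
    using that by (auto simp: chamber_def zero_le_mult_iff)
  \<comment> \<open>A point that names a chamber and lies on the new hyperplane is pushed off it into \<open>?S\<close>,
    without leaving the chamber.\<close>
  have ex: "\<exists>y \<in> generic_points L (insert a V) \<inter> ?S. chamber L V x = chamber L V y"
    if x: "x \<in> generic_points L V \<inter> ?S" for x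
  proof (cases "a \<bullet> x = 0")
    case False
    then show ?thesis
      using x by (intro bexI[of _ x]) (auto simp: generic_points_def)
  next
    case True
    obtain y where y: "y \<in> L" "a \<bullet> y \<noteq> 0"
      using a by blast
    define w where "w = (if a \<bullet> y < 0 then y else - y)"
    have w: "w \<in> L" "a \<bullet> w < 0"
      using y L by (auto simp: w_def subspace_neg)
    obtain e where e: "e > 0" "\<forall>v\<in>V. 0 < (v \<bullet> x) * (v \<bullet> (x + e *\<^sub>R w))"
      using same_side_perturbation[OF V, of x w] x by (auto simp: generic_points_def)
    have "x + e *\<^sub>R w \<in> open_chamber L V x"
      using e x w L by (auto simp: open_chamber_def subspace_add subspace_scale)
    moreover have "a \<bullet> (x + e *\<^sub>R w) < 0"
      using e(1) w True by (simp add: inner_right_distrib mult_pos_neg)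
    ultimately show ?thesis
      using chamber_eqI open_chamber_generic
      by (intro bexI[of _ "x + e *\<^sub>R w"]) (fastforce simp: generic_points_def)+
  qed
  have "(\<lambda>x. chamber L (insert a V) x \<inter> ?S) ` (generic_points L (insert a V) \<inter> ?S) =
      (\<lambda>x. chamber L V x \<inter> ?S) ` (generic_points L (insert a V) \<inter> ?S)"
    by (intro image_cong refl eq) (auto simp: generic_points_def)
  also have "\<dots> = (\<lambda>x. chamber L V x \<inter> ?S) ` (generic_points L V \<inter> ?S)"
  proof (intro equalityI subsetI)
    fix D assume "D \<in> (\<lambda>x. chamber L V x \<inter> ?S) ` (generic_points L V \<inter> ?S)"
    then show "D \<in> (\<lambda>x. chamber L V x \<inter> ?S) ` (generic_points L (insert a V) \<inter> ?S)"
      using ex by (smt (verit) image_iff)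
  qed (auto simp: generic_points_def)
  finally show ?thesis
    using L V by (simp add: fan_cut_chambers)
qed

text \<open>
  Transfers results about the halfspace \<open>a \<bullet> x \<le> 0\<close> to the opposite one.
\<close>
lemma chambers_uminus_normal: "chambers L (insert (- a) V) = chambers L (insert a V)"
  by (simp add: chambers_def chamber_def generic_points_def image_def)

lemma linear_hyperplane_hyperplane_in:
  assumes L: "subspace L" and a: "\<exists>y\<in>L. a \<bullet> y \<noteq> 0"
  shows "linear_hyperplane L (hyperplane_in L a)"
proof -
  have eq: "hyperplane_in L a = L \<inter> {x. a \<bullet> x = 0}"
    by (auto simp: hyperplane_in_def)
  have s: "subspace (hyperplane_in L a)"
    unfolding eq by (intro subspace_inter L subspace_hyperplane)
  have "aff_dim (L \<inter> {x. a \<bullet> x = 0}) = aff_dim L - 1"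
    using a subspace_0[OF L]
    by (subst aff_dim_affine_Int_hyperplane[OF subspace_imp_affine[OF L]]) auto
  then have "dim L = dim (hyperplane_in L a) + 1"
    using aff_dim_subspace[OF L] aff_dim_subspace[OF s] by (simp add: eq)
  then show ?thesis
    using s by (auto simp: linear_hyperplane_def hyperplane_in_def)
qed

text \<open>
  Cut both the larger and the smaller fan along the new hyperplane. The two halfspace terms
  agree; the hyperplane term vanishes for the larger fan and is the restricted arrangement for the
  smaller one. If a normal in \<open>V\<close> is proportional to \<open>a\<close> on \<open>L\<close>, then the new
  hyperplane is an old one, and the restricted fan is empty accordingly.
\<close>
lemma fan_valuation_chambers_insert:
  assumes \<phi>: "fan_valuation \<phi>" and L: "subspace L" and V: "finite V"
    and a: "\<exists>y\<in>L. a \<bullet> y \<noteq> 0"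
  shows "\<phi> (chambers L (insert a V)) =
    \<phi> (chambers L V) + \<phi> (chambers (hyperplane_in L a) V)"
proof (cases "generic_points L V = {}")
  case True
  then have "generic_points L (insert a V) = {}" "generic_points (hyperplane_in L a) V = {}"
    by (auto simp: generic_points_def hyperplane_in_def)
  then show ?thesis
    using True \<phi> by (simp add: chambers_def fan_valuation_def)
next
  case False
  then have "\<forall>v\<in>insert a V. \<exists>y\<in>L. v \<bullet> y \<noteq> 0"
    using a by (auto simp: generic_points_def)
  then have ne: "chambers L (insert a V) \<noteq> {}" "chambers L V \<noteq> {}"
    using generic_points_nonempty[OF _ L] V False by (auto simp: chambers_def)
  have cut: "\<phi> (chambers L W) = \<phi> (fan_cut (chambers L W) {x \<in> L. a \<bullet> x \<le> 0})
      + \<phi> (fan_cut (chambers L W) {x \<in> L. a \<bullet> x \<ge> 0})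
      - \<phi> (fan_cut (chambers L W) (hyperplane_in L a))"
    if "finite W" "chambers L W \<noteq> {}" for W
  proof -
    have "fan (chambers L W) \<and> chambers L W \<noteq> {} \<and>
        linear_hyperplane (lin_fan (chambers L W)) (hyperplane_in L a) \<and>
        hyperplane_in L a = {x \<in> lin_fan (chambers L W). a \<bullet> x = 0}"
      using fan_chambers[OF L that(1)] that(2) linear_hyperplane_hyperplane_in[OF L a]
      by (simp add: lin_fan_chambers[OF L that] hyperplane_in_def)
    from conjunct2[OF \<phi>[unfolded fan_valuation_def], rule_format, OF this]
    show ?thesis
      by (simp only: lin_fan_chambers[OF L that])
  qed
  have ge: "fan_cut (chambers L (insert a V)) {x \<in> L. a \<bullet> x \<ge> 0} =
      fan_cut (chambers L V) {x \<in> L. a \<bullet> x \<ge> 0}"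
    using fan_cut_chambers_insert_halfspace[OF L V, of "- a"] a
    by (simp add: chambers_uminus_normal)
  show ?thesis
    using cut[of V] cut[of "insert a V"] ne V ge
      fan_cut_chambers_insert_halfspace[OF L V a] fan_cut_chambers_hyperplane[OF L V]
      fan_cut_chambers_insert_hyperplane[OF L V] \<phi>
    by (simp add: fan_valuation_def)
qed

section \<open>Deletion and restriction\<close>

lemma arrangement_normals:
  assumes "arrangement L A"
  obtains a where "\<And>H. H \<in> A \<Longrightarrow> hyperplane_in L (a H) = H"
    and "\<And>H. H \<in> A \<Longrightarrow> \<exists>y\<in>L. a H \<bullet> y \<noteq> 0"
proof -
  have "\<exists>a. hyperplane_in L a = H \<and> (\<exists>y\<in>L. a \<bullet> y \<noteq> 0)" if "H \<in> A" for H
  proof -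
    have H: "subspace L" "linear_hyperplane L H"
      using assms that by (auto simp: arrangement_def)
    then obtain a where a: "hyperplane_in L a = H"
      unfolding hyperplane_in_def using linear_hyperplane_normal by metis
    moreover have "H \<noteq> L"
      using H by (auto simp: linear_hyperplane_def)
    ultimately show ?thesis
      by (auto simp: hyperplane_in_def)
  qed
  then show ?thesis
    using that by metis
qed

lemma fan_valuation_arrangement_fan_insert:
  assumes \<phi>: "fan_valuation \<phi>" and A: "arrangement L A" and H: "H \<in> A"
  shows "\<phi> (arrangement_fan L A) =
    \<phi> (arrangement_fan L (deletion A H)) + \<phi> (arrangement_fan H (restriction A H))"
proof -
  obtain a where a: "\<And>K. K \<in> A \<Longrightarrow> hyperplane_in L (a K) = K"
      "\<And>K. K \<in> A \<Longrightarrow> \<exists>y\<in>L. a K \<bullet> y \<noteq> 0"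
    using arrangement_normals[OF A] by blast
  let ?V = "a ` (A - {H})"
  have L: "subspace L" and sH: "subspace H" and V: "finite ?V"
    using A H by (auto simp: arrangement_def linear_hyperplane_def)
  have "A = hyperplane_in L ` insert (a H) ?V"
    using a(1) H by (force simp: image_image)
  moreover have "deletion A H = hyperplane_in L ` ?V"
    using a(1) by (force simp: deletion_def image_image)
  moreover have "restriction A H = hyperplane_in H ` ?V"
  proof -
    have "K \<inter> H = hyperplane_in H (a K)" if "K \<in> A" for K
      using a(1)[OF that] a(1)[OF H] by (auto simp: hyperplane_in_def)
    then show ?thesis
      by (auto simp: restriction_def image_image)
  qed
  ultimately show ?thesis
    using fan_valuation_chambers_insert[OF \<phi> L V a(2)[OF H]] a(1)[OF H]
      arrangement_fan_eq_chambers[OF L] arrangement_fan_eq_chambers[OF sH]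
    by metis
qed

text \<open>
  The empty set of hyperplanes is not an arrangement, but its fan makes the deletion-restriction
  rule applicable to singletons too.
\<close>
lemma arrangement_fan_empty:
  assumes "subspace L"
  shows "arrangement_fan L {} = {L}"
  using arrangement_fan_eq_chambers[OF assms, of "{}"] subspace_0[OF assms]
  by (auto simp: chambers_def chamber_def generic_points_def)

text \<open>
  Deleting the only hyperplane \<open>H\<close> of a singleton leaves the fan \<open>{L}\<close>, restricting to it the fan
  \<open>{H}\<close>. This is where the two terms of \<open>t^k + t^(k - 1)\<close> come from.
\<close>
lemma fan_valuation_singleton:
  assumes \<phi>: "fan_valuation \<phi>" and A: "singleton_arrangement k L A"
    and g: "\<And>M. subspace M \<Longrightarrow> \<phi> {M} = g (dim M)"
  shows "\<phi> (arrangement_fan L A) = g k + g (k - 1)"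
proof -
  obtain H where H: "A = {H}" and arr: "arrangement L A" and k: "dim L = k"
    using A by (auto simp: singleton_arrangement_def is_singleton_def)
  have "deletion A H = {}" "restriction A H = {}" "subspace L" "subspace H" "dim H = k - 1"
    using arr k by (auto simp: H deletion_def restriction_def arrangement_def linear_hyperplane_def)
  then show ?thesis
    using fan_valuation_arrangement_fan_insert[OF \<phi> arr, of H] g k
    by (simp add: H arrangement_fan_empty)
qed

lemma arrangement_deletion:
  assumes "arrangement L A" "\<not> is_singleton A" "H \<in> A"
  shows "arrangement L (deletion A H)"
  using assms by (auto simp: arrangement_def deletion_def is_singleton_def)

lemma arrangement_restriction:
  assumes A: "arrangement L A" "\<not> is_singleton A" and H: "H \<in> A"
  shows "arrangement H (restriction A H)"
proof -
  obtain a where a: "\<And>K. K \<in> A \<Longrightarrow> hyperplane_in L (a K) = K"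
    using arrangement_normals[OF A(1)] by metis
  have hyp: "linear_hyperplane H (K \<inter> H)" if K: "K \<in> A" "K \<noteq> H" for K
  proof -
    have "linear_hyperplane L H" "linear_hyperplane L K"
      using A(1) H K(1) by (auto simp: arrangement_def)
    then have s: "subspace H" "subspace K" and "dim H = dim K" "H \<subseteq> L"
      by (auto simp: linear_hyperplane_def)
    then have "\<not> H \<subseteq> K"
      using subspace_dim_equal[of H K] K(2) by auto
    then have "\<exists>y\<in>H. a K \<bullet> y \<noteq> 0"
      using a[OF K(1)] \<open>H \<subseteq> L\<close> by (auto simp: hyperplane_in_def)
    moreover have "hyperplane_in H (a K) = K \<inter> H"
      using a[OF K(1)] \<open>H \<subseteq> L\<close> by (auto simp: hyperplane_in_def)
    ultimately show ?thesis
      using linear_hyperplane_hyperplane_in[OF s(1)] by metis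
  qed
  have "subspace H" "finite A"
    using A(1) H by (auto simp: arrangement_def linear_hyperplane_def)
  moreover have "restriction A H = (\<lambda>K. K \<inter> H) ` (A - {H})"
    by (auto simp: restriction_def)
  moreover have "A - {H} \<noteq> {}"
    using A(2) H by (auto simp: is_singleton_def)
  ultimately show ?thesis
    using hyp by (auto simp: arrangement_def)
qed

text \<open>
  The recursion that computes the characteristic polynomial, as an induction principle; a
  restriction may merge hyperplanes, so it has at most as many as the deletion.
\<close>
lemma arrangement_induct [consumes 1, case_names singleton deletion_restriction]:
  assumes "arrangement L A"
    and "\<And>k L A. singleton_arrangement k L A \<Longrightarrow> P L A"
    and "\<And>L A H. \<lbrakk>arrangement L A; \<not> is_singleton A; H \<in> A;
      P L (deletion A H); P H (restriction A H)\<rbrakk> \<Longrightarrow> P L A"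
  shows "P L A"
  using assms(1)
proof (induction "card A" arbitrary: L A rule: less_induct)
  case less
  show ?case
  proof (cases "is_singleton A")
    case True
    then show ?thesis
      using assms(2) less.prems by (auto simp: singleton_arrangement_def)
  next
    case False
    obtain H where H: "H \<in> A" and fin: "finite A"
      using less.prems by (auto simp: arrangement_def)
    have del: "deletion A H = A - {H}"
      by (auto simp: deletion_def)
    have "restriction A H = (\<lambda>K. K \<inter> H) ` (A - {H})"
      by (auto simp: restriction_def)
    then have "card (restriction A H) \<le> card (A - {H})"
      using fin by (simp add: card_image_le)
    moreover have "card (A - {H}) < card A"
      using fin H by (rule card_Diff1_less)
    ultimately show ?thesis
      using assms(3)[OF less.prems False H] less.hyps del
        arrangement_deletion[OF less.prems False H] arrangement_restriction[OF less.prems False H]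
      by simp
  qed
qed

section \<open>Whitney numbers\<close>

lemma nat_multiple_simps [simp]:
  "nat_multiple 0 g = 0" "nat_multiple (Suc n) g = nat_multiple n g + g"
  by (simp_all add: nat_multiple_def)

lemma nat_multiple_add: "nat_multiple (m + n) g = nat_multiple m g + nat_multiple n g"
  by (induction m) (simp_all add: algebra_simps)

lemma sum_nat_multiple_monom:
  assumes "k \<le> n"
  shows "(\<Sum>i = 0..n. nat_multiple (coeff (monom 1 k) i) (g i)) = g k"
proof -
  have "nat_multiple (coeff (monom 1 k) i) (g i) = (if k = i then g i else 0)" for i
    by simp
  then show ?thesis
    using assms by simp
qed

text \<open>
  Both sides obey the same recursion, and they agree on singletons. The polynomial is any result
  of the recursion, and \<open>n\<close> is any bound of the dimension: this freedom is used to show that the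
  recursion has only one result.
\<close>
lemma fan_valuation_eq_char_poly_sum:
  assumes \<phi>: "fan_valuation \<phi>" and g: "\<And>M. subspace M \<Longrightarrow> \<phi> {M} = g (dim M)"
    and "unsigned_char_poly_rel L A p" and "dim L \<le> n"
  shows "\<phi> (arrangement_fan L A) = (\<Sum>i = 0..n. nat_multiple (coeff p i) (g i))"
  using assms(3,4)
proof (induction rule: unsigned_char_poly_rel.induct)
  case (singleton k L A)
  then have "k \<le> n"
    by (simp add: singleton_arrangement_def)
  then show ?case
    using fan_valuation_singleton[OF \<phi> singleton.hyps g]
    by (simp add: nat_multiple_add sum.distrib sum_nat_multiple_monom del: coeff_monom One_nat_def)
next
  case (deletion_restriction L A H p q)
  have "dim H \<le> n"
    using deletion_restriction by (auto simp: arrangement_def linear_hyperplane_def)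
  then show ?case
    using deletion_restriction fan_valuation_arrangement_fan_insert[OF \<phi>]
    by (simp add: nat_multiple_add sum.distrib)
qed

lemma unsigned_char_poly_rel_exists:
  assumes "arrangement L A"
  shows "\<exists>p. unsigned_char_poly_rel L A p"
  using assms
  by (induction rule: arrangement_induct) (blast intro: unsigned_char_poly_rel.intros)+

section \<open>Valuations from intersections with generic convex sets\<close>

text \<open>
  An ultrafilter is a minimal proper filter: a filter on which neither \<open>P\<close> nor its negation holds
  eventually can be refined by adding \<open>P\<close>.
\<close>
lemma ultrafilter_exists:
  fixes F :: "'a filter"
  assumes "F \<noteq> bot"
  obtains U where "U \<le> F" "U \<noteq> bot" "\<And>P. eventually P U \<or> eventually (\<lambda>x. \<not> P x) U"
proof -
  let ?A = "{G. G \<noteq> bot \<and> G \<le> F}"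
  have "\<exists>U\<in>?A. \<forall>G\<in>?A. G \<le> U \<longrightarrow> G = U"
  proof (rule predicate_Zorn)
    show "partial_order_on ?A (relation_of (\<lambda>G H. H \<le> G) ?A)"
      by (rule partial_order_on_relation_ofI) auto
    fix \<C> assume "\<C> \<in> Chains (relation_of (\<lambda>G H. H \<le> G) ?A)"
    then have C: "\<C> \<subseteq> ?A" "\<And>G H. G \<in> \<C> \<Longrightarrow> H \<in> \<C> \<Longrightarrow> G \<le> H \<or> H \<le> G"
      by (auto simp: Chains_def relation_of_def)
    show "\<exists>U\<in>?A. \<forall>G\<in>\<C>. U \<le> G"
    proof (cases "\<C> = {}")
      case True
      then show ?thesis
        using assms by auto
    next
      case False
      have "eventually P (Inf \<C>) \<longleftrightarrow> (\<exists>G\<in>\<C>. eventually P G)" for P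
        using C(2) by (intro eventually_Inf_base False) (metis inf.absorb1 inf.absorb2 order_refl)
      then have "Inf \<C> \<noteq> bot"
        using C(1) by (auto simp: trivial_limit_def)
      moreover obtain G where "G \<in> \<C>"
        using False by blast
      then have "Inf \<C> \<le> F"
        using C(1) order_trans[OF Inf_lower[of G \<C>], of F] by blast
      ultimately show ?thesis
        by (intro bexI[of _ "Inf \<C>"]) (simp_all add: Inf_lower)
    qed
  qed
  then obtain U where U: "U \<noteq> bot" "U \<le> F"
      and max': "\<And>G. \<lbrakk>G \<noteq> bot; G \<le> F; G \<le> U\<rbrakk> \<Longrightarrow> G = U"
    by auto
  have max: "G = U" if "G \<noteq> bot" "G \<le> U" for G
    using max'[OF that(1) order_trans[OF that(2) U(2)] that(2)] .
  have "eventually P U \<or> eventually (\<lambda>x. \<not> P x) U" for P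
  proof (rule disjCI)
    assume not: "\<not> eventually (\<lambda>x. \<not> P x) U"
    have "inf U (principal {x. P x}) \<noteq> bot"
      using not by (simp add: trivial_limit_def eventually_inf_principal)
    then have "inf U (principal {x. P x}) = U"
      by (rule max) simp
    then have "U \<le> principal {x. P x}"
      by (metis inf.cobounded2)
    then show "eventually P U"
      by (simp add: le_principal)
  qed
  then show ?thesis
    using that U by blast
qed

text \<open>
  The hyperplanes orthogonal to one nonzero vector from each subspace do not cover the space.
\<close>
lemma generic_vector:
  assumes "finite \<L>" and "\<And>L. L \<in> \<L> \<Longrightarrow> subspace L"
  shows "\<exists>u::'a::euclidean_space. \<forall>L\<in>\<L>. L \<noteq> {0} \<longrightarrow> (\<exists>x\<in>L. u \<bullet> x \<noteq> 0)"
proof -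
  let ?M = "\<L> - {{0}}"
  have "\<exists>x\<in>L. x \<noteq> 0" if "L \<in> ?M" for L
    using that assms(2)[of L] subspace_0[of L] by auto
  then obtain v where v: "\<And>L. L \<in> ?M \<Longrightarrow> v L \<in> L \<and> v L \<noteq> 0"
    by metis
  have "\<forall>w\<in>v ` ?M. \<exists>y\<in>UNIV. w \<bullet> y \<noteq> 0"
    using v by (metis imageE inner_eq_zero_iff UNIV_I)
  then have "generic_points UNIV (v ` ?M) \<noteq> {}"
    using assms(1) by (intro generic_points_nonempty) auto
  then obtain u where "\<And>L. L \<in> ?M \<Longrightarrow> v L \<bullet> u \<noteq> 0"
    by (auto simp: generic_points_def)
  then show ?thesis
    using v by (metis DiffI inner_commute singletonD)
qed

text \<open>
  The set \<open>E\<close> is the intersection of \<open>j\<close> generic linear hyperplanes and an open halfspace: each generic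
  hyperplane lowers the dimension of every nonzero \<open>L\<close> by one, and the final halfspace misses
  exactly those \<open>L\<close> that have been cut down to the origin.
\<close>
lemma generic_convex_set:
  assumes "finite \<L>" and "\<And>L. L \<in> \<L> \<Longrightarrow> subspace L"
  shows "\<exists>E :: 'a::euclidean_space set. convex E \<and> (\<forall>L\<in>\<L>. L \<inter> E \<noteq> {} \<longleftrightarrow> j < dim L)"
  using assms
proof (induction j arbitrary: \<L>)
  case 0
  obtain u where u: "\<And>L. \<lbrakk>L \<in> \<L>; L \<noteq> {0}\<rbrakk> \<Longrightarrow> \<exists>x\<in>L. u \<bullet> x \<noteq> 0"
    using generic_vector[OF 0] by blast
  have "L \<inter> {x. 0 < u \<bullet> x} \<noteq> {} \<longleftrightarrow> 0 < dim L" if L: "L \<in> \<L>" for L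
  proof (cases "L = {0}")
    case False
    then obtain x where x: "x \<in> L" "u \<bullet> x \<noteq> 0"
      using L u by auto
    have "- x \<in> L"
      using x 0(2)[OF L] by (simp add: subspace_neg)
    then have "L \<inter> {x. 0 < u \<bullet> x} \<noteq> {}"
      using x by (cases "0 < u \<bullet> x") (auto simp: disjoint_iff intro!: bexI[of _ "- x"])
    moreover have "\<not> L \<subseteq> {0}"
      using x by auto
    ultimately show ?thesis
      by (simp add: dim_eq_0 zero_less_iff_neq_zero)
  qed simp
  then show ?case
    by (intro exI[of _ "{x. 0 < u \<bullet> x}"] conjI ballI convex_halfspace_gt)
next
  case (Suc j)
  obtain u where u: "\<And>L. \<lbrakk>L \<in> \<L>; L \<noteq> {0}\<rbrakk> \<Longrightarrow> \<exists>x\<in>L. u \<bullet> x \<noteq> 0"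
    using generic_vector[OF Suc.prems] by blast
  have eq: "hyperplane_in L u = L \<inter> {x. u \<bullet> x = 0}" for L
    by (auto simp: hyperplane_in_def)
  have sub: "subspace (hyperplane_in L u)" if "L \<in> \<L>" for L
    unfolding eq using Suc.prems(2)[OF that] by (intro subspace_inter subspace_hyperplane)
  have "\<exists>E. convex E \<and> (\<forall>M\<in>(\<lambda>L. hyperplane_in L u) ` \<L>. M \<inter> E \<noteq> {} \<longleftrightarrow> j < dim M)"
    using Suc.prems(1) sub by (intro Suc.IH) auto
  then obtain E where E: "convex E"
      "\<And>L. L \<in> \<L> \<Longrightarrow> hyperplane_in L u \<inter> E \<noteq> {} \<longleftrightarrow> j < dim (hyperplane_in L u)"
    by auto
  have "L \<inter> (E \<inter> {x. u \<bullet> x = 0}) \<noteq> {} \<longleftrightarrow> Suc j < dim L" if L: "L \<in> \<L>" for L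
  proof (cases "L = {0}")
    case True
    have "hyperplane_in L u = {0}"
      using True by (auto simp: hyperplane_in_def)
    then have "hyperplane_in L u \<inter> E = {}"
      using E(2)[OF L] by simp
    then show ?thesis
      using True by (auto simp: hyperplane_in_def)
  next
    case False
    have "dim L = dim (hyperplane_in L u) + 1"
      using linear_hyperplane_hyperplane_in[OF Suc.prems(2) u] L False
      by (simp add: linear_hyperplane_def)
    then show ?thesis
      using E(2)[OF L] by (simp add: eq Int_ac)
  qed
  then show ?case
    using E(1) convex_hyperplane by (intro exI[of _ "E \<inter> {x. u \<bullet> x = 0}"] conjI ballI convex_Int)
qed

text \<open>
  How the predicate that \<open>C\<close> meets a fixed convex set behaves when \<open>C\<close> is cut by a hyperplane.
\<close>
definition cut_compatible :: "('a::euclidean_space set \<Rightarrow> bool) \<Rightarrow> bool" where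
  "cut_compatible q \<longleftrightarrow> (\<forall>C a. convex C \<longrightarrow>
     q C = (q (C \<inter> {x. a \<bullet> x \<le> 0}) \<or> q (C \<inter> {x. a \<bullet> x \<ge> 0})) \<and>
     q (C \<inter> {x. a \<bullet> x = 0}) = (q (C \<inter> {x. a \<bullet> x \<le> 0}) \<and> q (C \<inter> {x. a \<bullet> x \<ge> 0})))"

text \<open>
  For \<open>0 < j < DIM('a)\<close> no single convex set meets exactly the subspaces of dimension above \<open>j\<close>, since
  each of its points spans a subspace of dimension at most one. However, for finitely
  many subspaces there is such a set, so there is an ultrafilter on sets along which \<open>E\<close> is eventually in
  general position to every given subspace. Meeting \<open>E\<close> eventually along it is the limit of the predicates
  of meeting a fixed convex set; since an ultrafilter commutes with disjunction as
  well as with conjunction, the limit is still compatible with cuts.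
\<close>
lemma cut_compatible_generic_meet:
  obtains q :: "'a::euclidean_space set \<Rightarrow> bool"
  where "cut_compatible q" and "\<And>L. subspace L \<Longrightarrow> q L \<longleftrightarrow> j < dim L"
proof -
  let ?good = "\<lambda>L. {E :: 'a set. convex E \<and> (L \<inter> E \<noteq> {} \<longleftrightarrow> j < dim L)}"
  have "(INF L\<in>Collect subspace. principal (?good L)) \<noteq> bot"
  proof (rule INF_filter_not_bot)
    fix \<L> :: "'a set set" assume L: "\<L> \<subseteq> Collect subspace" "finite \<L>"
    then obtain E :: "'a set" where "convex E" "\<And>L. L \<in> \<L> \<Longrightarrow> L \<inter> E \<noteq> {} \<longleftrightarrow> j < dim L"
      using generic_convex_set[of \<L> j] by (metis mem_Collect_eq subsetD)
    then have "E \<in> (\<Inter>L\<in>\<L>. ?good L)"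
      by simp
    then have "(\<Inter>L\<in>\<L>. ?good L) \<noteq> {}"
      by (metis empty_iff)
    then show "(INF L\<in>\<L>. principal (?good L)) \<noteq> bot"
      using L by (simp add: INF_principal_finite principal_eq_bot_iff)
  qed
  then obtain U where U: "U \<le> (INF L\<in>Collect subspace. principal (?good L))" "U \<noteq> bot"
      and ultra: "\<And>P. eventually P U \<or> eventually (\<lambda>E. \<not> P E) U"
    using ultrafilter_exists by blast
  have good: "eventually (\<lambda>E. convex E \<and> (L \<inter> E \<noteq> {} \<longleftrightarrow> j < dim L)) U" if "subspace L" for L
  proof -
    have "U \<le> principal (?good L)"
      using U(1) that by (meson INF_lower mem_Collect_eq order_trans)
    then show ?thesis
      by (simp add: le_principal)
  qed
  have conv: "eventually convex U"
    using good[OF subspace_UNIV] by eventually_elim simp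
  have disj: "eventually (\<lambda>E. P E \<or> Q E) U \<longleftrightarrow> eventually P U \<or> eventually Q U" for P Q
  proof
    assume PQ: "eventually (\<lambda>E. P E \<or> Q E) U"
    show "eventually P U \<or> eventually Q U"
    proof (rule disjCI)
      assume "\<not> eventually Q U"
      then have "eventually (\<lambda>E. \<not> Q E) U"
        using ultra by blast
      with PQ show "eventually P U"
        by eventually_elim blast
    qed
  qed (auto elim: eventually_mono)
  let ?q = "\<lambda>C. eventually (\<lambda>E. C \<inter> E \<noteq> {}) U"
  have "cut_compatible ?q"
    unfolding cut_compatible_def
  proof (intro allI impI conjI)
    fix C :: "'a set" and a assume C: "convex C"
    let ?le = "C \<inter> {x. a \<bullet> x \<le> 0}" and ?ge = "C \<inter> {x. a \<bullet> x \<ge> 0}" and ?eq = "C \<inter> {x. a \<bullet> x = 0}"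
    have "(\<lambda>E. C \<inter> E \<noteq> {}) = (\<lambda>E. ?le \<inter> E \<noteq> {} \<or> ?ge \<inter> E \<noteq> {})"
      using linear by (fastforce simp: fun_eq_iff)
    then show "?q C = (?q ?le \<or> ?q ?ge)"
      by (simp only: disj)
    \<comment> \<open>A convex set that meets \<open>C\<close> on both sides of the hyperplane contains the segment
      between the two points, which crosses the hyperplane inside \<open>C\<close>.\<close>
    have "eventually (\<lambda>E. ?eq \<inter> E \<noteq> {} \<longleftrightarrow> ?le \<inter> E \<noteq> {} \<and> ?ge \<inter> E \<noteq> {}) U"
      using conv
    proof eventually_elim
      case (elim E)
      have "?eq \<inter> E \<noteq> {}" if xy: "x \<in> ?le \<inter> E" "y \<in> ?ge \<inter> E" for x y
      proof -
        have "connected (C \<inter> E)"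
          using C elim by (intro convex_connected convex_Int)
        then have "\<exists>z\<in>C \<inter> E. a \<bullet> z = 0"
          using xy by (intro connected_ivt_hyperplane[of _ x y]) auto
        then show ?thesis
          by auto
      qed
      then show ?case
        by fastforce
    qed
    then have "?q ?eq \<longleftrightarrow> eventually (\<lambda>E. ?le \<inter> E \<noteq> {} \<and> ?ge \<inter> E \<noteq> {}) U"
      by (rule eventually_cong)
    then show "?q ?eq = (?q ?le \<and> ?q ?ge)"
      by (simp only: eventually_conj_iff)
  qed
  moreover have "?q L \<longleftrightarrow> j < dim L" if L: "subspace L" for L
  proof -
    have "?q L \<longleftrightarrow> eventually (\<lambda>E. j < dim L) U"
      using good[OF L] by (intro eventually_cong) (auto elim: eventually_mono)
    then show ?thesis
      using U(2) by (cases "j < dim L") auto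
  qed
  ultimately show ?thesis
    using that by blast
qed

section \<open>Fan valuations as sums over cones\<close>

text \<open>
  If two cones of a fan have the same intersection with \<open>S\<close>, then their common face contains
  relative interior points of both, so it is equal to both. Hence a cut fan
  has one cone for each cone of the fan whose relative interior meets \<open>S\<close>.
\<close>
lemma inj_on_cut:
  assumes N: "fan N"
  shows "inj_on (\<lambda>C. C \<inter> S) {C \<in> N. rel_interior C \<inter> S \<noteq> {}}"
proof (rule inj_onI)
  fix C D
  assume C: "C \<in> {C \<in> N. rel_interior C \<inter> S \<noteq> {}}" and D: "D \<in> {C \<in> N. rel_interior C \<inter> S \<noteq> {}}"
    and eq: "C \<inter> S = D \<inter> S"
  have sub: "A \<inter> B = A"
    if A: "A \<in> N" "rel_interior A \<inter> S \<noteq> {}" and B: "B \<in> N" and "A \<inter> S = B \<inter> S" for A B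
  proof (rule ccontr)
    assume "A \<inter> B \<noteq> A"
    moreover have "(A \<inter> B) face_of A"
      using N A B by (auto simp: fan_def)
    ultimately have "A \<inter> B \<inter> rel_interior A = {}"
      using face_of_disjoint_rel_interior by blast
    then show False
      using that rel_interior_subset[of A] by blast
  qed
  show "C = D"
    using sub[of C D] sub[of D C] C D eq by auto
qed

definition cut_additive :: "('a::euclidean_space set \<Rightarrow> 'g::ab_group_add) \<Rightarrow> bool" where
  "cut_additive f \<longleftrightarrow> (\<forall>C a. convex C \<longrightarrow>
     f C = f (C \<inter> {x. a \<bullet> x \<le> 0}) + f (C \<inter> {x. a \<bullet> x \<ge> 0}) - f (C \<inter> {x. a \<bullet> x = 0}))"

text \<open>
  It suffices to cut the cones one by one. If the relative interior of a cone meets the hyperplane,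
  then all three parts occur and \<open>cut_additive\<close> applies; otherwise the cone lies in one of the
  halfspaces and occurs there only, as a whole.
\<close>
lemma fan_valuation_sum:
  assumes f: "cut_additive f"
  shows "fan_valuation (\<lambda>N. sum f N)"
  unfolding fan_valuation_def
proof (intro conjI allI impI)
  show "sum f {} = 0"
    by simp
  fix N :: "'a set set" and H a
  assume "fan N \<and> N \<noteq> {} \<and> linear_hyperplane (lin_fan N) H \<and> H = {x \<in> lin_fan N. a \<bullet> x = 0}"
  then have N: "fan N" and H: "H = {x \<in> lin_fan N. a \<bullet> x = 0}"
    by blast+
  let ?le = "{x \<in> lin_fan N. a \<bullet> x \<le> 0}" and ?ge = "{x \<in> lin_fan N. a \<bullet> x \<ge> 0}"
  have fin: "finite N"
    using N by (simp add: fan_def)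
  let ?h = "\<lambda>S C. if rel_interior C \<inter> S \<noteq> {} then f (C \<inter> S) else 0"
  have cut: "sum f (fan_cut N S) = (\<Sum>C\<in>N. ?h S C)" for S
  proof -
    have "fan_cut N S = (\<lambda>C. C \<inter> S) ` {C \<in> N. rel_interior C \<inter> S \<noteq> {}}"
      by (auto simp: fan_cut_def)
    then have "sum f (fan_cut N S) = (\<Sum>C\<in>{C \<in> N. rel_interior C \<inter> S \<noteq> {}}. f (C \<inter> S))"
      by (simp add: sum.reindex[OF inj_on_cut[OF N]])
    then show ?thesis
      using fin by (simp add: sum.inter_filter)
  qed
  have "f C = ?h ?le C + ?h ?ge C - ?h H C" if C: "C \<in> N" for C
  proof -
    have CL: "C \<subseteq> lin_fan N"
      using lin_fan_eq[OF N C] span_superset by simp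
    have poly: "polyhedral_cone C"
      using N C by (simp add: fan_def)
    have conv: "convex C" and cl: "closed C" and ne: "rel_interior C \<noteq> {}"
      using poly by (auto simp: polyhedral_cone_def polyhedron_imp_convex polyhedron_imp_closed
          rel_interior_eq_empty)
    have rel: "rel_interior C \<subseteq> C"
      by (rule rel_interior_subset)
    have sub: "C \<subseteq> D" if "rel_interior C \<subseteq> D" "closed D" for D
      using that closure_minimal[of "rel_interior C" D] convex_closure_rel_interior[OF conv] cl
      by (simp add: closure_closed)
    have eqs: "C \<inter> ?le = C \<inter> {x. a \<bullet> x \<le> 0}" "C \<inter> ?ge = C \<inter> {x. a \<bullet> x \<ge> 0}"
        "C \<inter> H = C \<inter> {x. a \<bullet> x = 0}"
      using CL H by auto
    have side: "(\<forall>x\<in>rel_interior C. a \<bullet> x < 0) \<or> (\<forall>x\<in>rel_interior C. a \<bullet> x > 0)"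
      if "rel_interior C \<inter> H = {}"
    proof (rule ccontr)
      assume "\<not> ?thesis"
      then obtain x y where "x \<in> rel_interior C" "y \<in> rel_interior C" "a \<bullet> x \<le> 0" "0 \<le> a \<bullet> y"
        by (meson linorder_not_less)
      moreover have "connected (rel_interior C)"
        by (intro convex_connected convex_rel_interior conv)
      ultimately obtain z where "z \<in> rel_interior C" "a \<bullet> z = 0"
        using connected_ivt_hyperplane by metis
      then show False
        using that rel CL H by auto
    qed
    show ?thesis
    proof (cases "rel_interior C \<inter> H = {}")
      case False
      then have "rel_interior C \<inter> ?le \<noteq> {}" "rel_interior C \<inter> ?ge \<noteq> {}"
        using H by auto
      then show ?thesis
        using False f conv unfolding cut_additive_def eqs by simp
    next
      case True
      show ?thesis
        using side[OF True]
      proof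
        assume neg: "\<forall>x\<in>rel_interior C. a \<bullet> x < 0"
        then have "C \<subseteq> {x. a \<bullet> x \<le> 0}"
          by (intro sub closed_halfspace_le) (auto simp: less_imp_le)
        then have "C \<inter> ?le = C"
          unfolding eqs by blast
        moreover have "rel_interior C \<inter> ?le \<noteq> {}" "rel_interior C \<inter> ?ge = {}"
          using neg ne rel CL by (fastforce simp: less_imp_le)+
        ultimately show ?thesis
          using True by simp
      next
        assume pos: "\<forall>x\<in>rel_interior C. a \<bullet> x > 0"
        then have "C \<subseteq> {x. a \<bullet> x \<ge> 0}"
          by (intro sub closed_halfspace_ge) (auto simp: less_imp_le)
        then have "C \<inter> ?ge = C"
          unfolding eqs by blast
        moreover have "rel_interior C \<inter> ?ge \<noteq> {}" "rel_interior C \<inter> ?le = {}"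
          using pos ne rel CL by (fastforce simp: less_imp_le)+
        ultimately show ?thesis
          using True by simp
      qed
    qed
  qed
  then have "sum f N = (\<Sum>C\<in>N. ?h ?le C + ?h ?ge C - ?h H C)"
    by (intro sum.cong refl)
  also have "\<dots> = sum f (fan_cut N ?le) + sum f (fan_cut N ?ge) - sum f (fan_cut N H)"
    by (simp only: cut sum.distrib sum_subtractf)
  finally show "sum f N = sum f (fan_cut N ?le) + sum f (fan_cut N ?ge) - sum f (fan_cut N H)" .
qed

text \<open>
  The value \<open>g (dim L)\<close> is telescoped as \<open>g 0\<close> plus the increments \<open>g (j + 1) - g j\<close> for \<open>j < dim L\<close>.
  A general cone receives the increments for which it meets a generic halfspace of a generic
  subspace of codimension \<open>j\<close>. This works in every abelian group, since each increment is
  taken or left and never scaled.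
\<close>
lemma fan_valuation_with_values_on_subspaces:
  fixes g :: "nat \<Rightarrow> 'g::ab_group_add"
  obtains \<phi> :: "'a::euclidean_space set set \<Rightarrow> 'g"
  where "fan_valuation \<phi>" and "\<And>L. subspace L \<Longrightarrow> \<phi> {L} = g (dim L)"
proof -
  have "\<exists>q :: 'a set \<Rightarrow> bool. cut_compatible q \<and> (\<forall>L. subspace L \<longrightarrow> (q L \<longleftrightarrow> j < dim L))" for j
    using cut_compatible_generic_meet by metis
  then obtain q :: "nat \<Rightarrow> 'a set \<Rightarrow> bool" where q: "\<And>j. cut_compatible (q j)"
      "\<And>j L. subspace L \<Longrightarrow> q j L \<longleftrightarrow> j < dim L"
    by metis
  let ?t = "\<lambda>j C. if q j C then g (Suc j) - g j else 0"
  define f where "f C = g 0 + (\<Sum>j<DIM('a). ?t j C)" for C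
  have "cut_additive f"
    unfolding cut_additive_def
  proof (intro allI impI)
    fix C :: "'a set" and a assume C: "convex C"
    let ?le = "C \<inter> {x. a \<bullet> x \<le> 0}" and ?ge = "C \<inter> {x. a \<bullet> x \<ge> 0}" and ?eq = "C \<inter> {x. a \<bullet> x = 0}"
    have "?t j C = ?t j ?le + ?t j ?ge - ?t j ?eq" for j
    proof -
      have "q j C = (q j ?le \<or> q j ?ge)" "q j ?eq = (q j ?le \<and> q j ?ge)"
        using q(1)[of j] C unfolding cut_compatible_def by blast+
      then show ?thesis
        by (cases "q j ?le"; cases "q j ?ge") simp_all
    qed
    then have "(\<Sum>j<DIM('a). ?t j C) = (\<Sum>j<DIM('a). ?t j ?le + ?t j ?ge - ?t j ?eq)"
      by (intro sum.cong refl)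
    then show "f C = f ?le + f ?ge - f ?eq"
      by (simp add: f_def sum.distrib sum_subtractf)
  qed
  moreover have "sum f {L} = g (dim L)" if L: "subspace L" for L
  proof -
    have "(\<Sum>j<DIM('a). ?t j L) = (\<Sum>j<DIM('a). if j < dim L then g (Suc j) - g j else 0)"
      by (simp add: q(2)[OF L])
    also have "\<dots> = (\<Sum>j\<in>{..<DIM('a)} \<inter> {j. j < dim L}. g (Suc j) - g j)"
      by (simp add: sum.inter_restrict)
    also have "{..<DIM('a)} \<inter> {j. j < dim L} = {..<dim L}"
      using dim_subset_UNIV[of L] by auto
    also have "(\<Sum>j<dim L. g (Suc j) - g j) = g (dim L) - g 0"
      by (rule sum_lessThan_telescope)
    finally show ?thesis
      by (simp add: f_def)
  qed
  ultimately show ?thesis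
    using that fan_valuation_sum by blast
qed

section \<open>Uniqueness of the characteristic polynomial\<close>

text \<open>
  Each coefficient is the value of a fan valuation, which does not depend on how the recursion was
  carried out.
\<close>
lemma unsigned_char_poly_rel_unique:
  fixes L :: "'a::euclidean_space set"
  assumes "unsigned_char_poly_rel L A p" and "unsigned_char_poly_rel L A q"
  shows "p = q"
proof (rule poly_eqI)
  fix i
  define g :: "nat \<Rightarrow> int" where "g k = (if k = i then 1 else 0)" for k
  obtain \<phi> :: "'a set set \<Rightarrow> int" where \<phi>: "fan_valuation \<phi>" "\<And>M. subspace M \<Longrightarrow> \<phi> {M} = g (dim M)"
    using fan_valuation_with_values_on_subspaces by blast
  have nat_mult: "nat_multiple n k = int n * k" for n k
    by (simp add: nat_multiple_def)
  have "\<phi> (arrangement_fan L A) = int (coeff r i)" if "unsigned_char_poly_rel L A r" for r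
    using fan_valuation_eq_char_poly_sum[OF \<phi> that, of "max i (dim L)"]
    by (simp add: nat_mult g_def if_distrib cong: if_cong)
  then show "coeff p i = coeff q i"
    using assms by (metis of_nat_eq_iff)
qed

lemma unsigned_char_poly_rel_unsigned_char_poly:
  assumes "arrangement L A"
  shows "unsigned_char_poly_rel L A (unsigned_char_poly L A)"
  unfolding unsigned_char_poly_def
  using unsigned_char_poly_rel_exists[OF assms] unsigned_char_poly_rel_unique by (metis theI)

lemma fan_valuation_eq_whitney_sum:
  fixes L :: "'a::euclidean_space set"
  assumes "fan_valuation \<phi>" and "\<And>M. subspace M \<Longrightarrow> \<phi> {M} = g (dim M)"
    and A: "arrangement L A"
  shows "\<phi> (arrangement_fan L A) = (\<Sum>i = 0..DIM('a). nat_multiple (whitney_number i L A) (g i))"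
  unfolding whitney_number_def
  using assms(1,2) unsigned_char_poly_rel_unsigned_char_poly[OF A] dim_subset_UNIV
  by (rule fan_valuation_eq_char_poly_sum)

section \<open>Rotations and subspaces\<close>

text \<open>
  Orthonormal bases of \<open>L\<close> and of its orthogonal complement, indexed by \<open>I\<close> and its complement.
\<close>
lemma orthonormal_columns_spanning:
  fixes L :: "(real^'n) set"
  assumes L: "subspace L" and I: "card I = dim L"
  obtains b :: "'n \<Rightarrow> real^'n" where "\<And>i. norm (b i) = 1"
    and "\<And>i j. i \<noteq> j \<Longrightarrow> orthogonal (b i) (b j)" and "span (b ` I) = L"
proof -
  define M where "M = {y. \<forall>x\<in>L. orthogonal x y}"
  have M: "subspace M"
    unfolding M_def using subspace_orthogonal_to_vectors by blast
  have dimM: "dim M + dim L = CARD('n)"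
    using dim_subspace_orthogonal_to_vectors[OF L subspace_UNIV] by (simp add: M_def)
  obtain B where B: "B \<subseteq> L" "pairwise orthogonal B" "\<And>x. x \<in> B \<Longrightarrow> norm x = 1"
      "independent B" "card B = dim L" "span B = L"
    using orthonormal_basis_subspace[OF L] by metis
  obtain D where D: "D \<subseteq> M" "pairwise orthogonal D" "\<And>x. x \<in> D \<Longrightarrow> norm x = 1"
      "independent D" "card D = dim M" "span D = M"
    using orthonormal_basis_subspace[OF M] by metis
  have "finite B" "finite D"
    using B(4) D(4) by (auto intro: independent_imp_finite)
  obtain f where f: "bij_betw f I B"
    using I B(5) \<open>finite B\<close> by (metis finite finite_same_card_bij)
  have "card (- I) = card D"
    using I dimM D(5) by (simp add: Compl_eq_Diff_UNIV card_Diff_subset)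
  then obtain h where h: "bij_betw h (- I) D"
    using \<open>finite D\<close> by (metis finite finite_same_card_bij)
  define b where "b i = (if i \<in> I then f i else h i)" for i
  have bI: "b i \<in> B" if "i \<in> I" for i
    using that f by (auto simp: b_def bij_betw_def)
  have bC: "b i \<in> D" if "i \<notin> I" for i
    using that h by (auto simp: b_def bij_betw_def)
  have inj: "b i \<noteq> b j" if "i \<noteq> j" "i \<in> I \<longleftrightarrow> j \<in> I" for i j
    using that f h by (auto simp: b_def bij_betw_def inj_on_def)
  have LM: "orthogonal x y" if "x \<in> B" "y \<in> D" for x y
    using that B(1) D(1) by (auto simp: M_def)
  show ?thesis
  proof
    show "norm (b i) = 1" for i
      using bI bC B(3) D(3) by metis
    show "orthogonal (b i) (b j)" if "i \<noteq> j" for i j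
    proof (cases "i \<in> I \<longleftrightarrow> j \<in> I")
      case True
      then show ?thesis
        using bI bC inj[OF that True] B(2) D(2) by (metis pairwiseD)
    next
      case False
      then show ?thesis
        using bI bC LM by (metis orthogonal_commute)
    qed
    have "b ` I = B"
      using f by (auto simp: b_def bij_betw_def)
    then show "span (b ` I) = L"
      using B(6) by simp
  qed
qed

text \<open>
  The columns of the matrix are an orthonormal basis adapted to \<open>L\<close>. Negating one of them changes
  the sign of the determinant but not the spans of sets of columns.
\<close>
lemma rotation_onto_subspace:
  fixes L :: "(real^'n) set"
  assumes L: "subspace L" and I: "card I = dim L"
  obtains Q :: "real^'n^'n" where "rotation_matrix Q" "(*v) Q ` span ((\<lambda>i. axis i 1) ` I) = L"
proof -
  obtain b :: "'n \<Rightarrow> real^'n" where b: "\<And>i. norm (b i) = 1"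
      "\<And>i j. i \<noteq> j \<Longrightarrow> orthogonal (b i) (b j)" "span (b ` I) = L"
    using orthonormal_columns_spanning[OF assms] by metis
  \<comment> \<open>The column that may be negated; every index does.\<close>
  fix k :: 'n
  define Q where "Q s = (\<chi> i j. (if j = k then s else 1) * b j $ i)" for s :: real
  have col: "column j (Q s) = (if j = k then s else 1) *\<^sub>R b j" for j s
    by (simp add: Q_def column_def vec_eq_iff)
  have orth: "orthogonal_matrix (Q s)" if "\<bar>s\<bar> = 1" for s
    using b(1,2) that by (auto simp: orthogonal_matrix_orthonormal_columns col orthogonal_clauses)
  have det: "det (Q (-1)) = - det (Q 1)"
  proof -
    have "transpose (Q s) = (\<chi> j. if j = k then s *s b j else b j)" for s
      by (simp add: Q_def transpose_def vec_eq_iff)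
    then have "det (transpose (Q s)) = s * det (\<chi> j. if j = k then b j else b j)" for s
      using det_row_mul[of k s b b] by simp
    then have "det (Q s) = s * det (\<chi> j. if j = k then b j else b j)" for s
      by (metis det_transpose)
    then show ?thesis
      by simp
  qed
  have "\<exists>s. \<bar>s\<bar> = 1 \<and> det (Q s) = 1"
    using det_orthogonal_matrix[OF orth[of 1]] det by (metis abs_1 abs_minus minus_minus)
  then obtain s where s: "\<bar>s\<bar> = 1" "det (Q s) = 1"
    by blast
  have "(*v) (Q s) ` span ((\<lambda>i. axis i 1) ` I) = span ((*v) (Q s) ` (\<lambda>i. axis i 1) ` I)"
    by (intro linear_span_image[symmetric] matrix_vector_mul_linear)
  also have "(*v) (Q s) ` (\<lambda>i. axis i 1) ` I = (\<lambda>i. column i (Q s)) ` I"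
    by (simp add: image_image matrix_vector_mult_basis)
  also have "span \<dots> = span (b ` I)"
  proof -
    have "(\<lambda>i. column i (Q s)) ` I \<subseteq> span (b ` I)"
      by (auto simp: col span_base span_scale)
    moreover have "b i \<in> span ((\<lambda>i. column i (Q s)) ` I)" if "i \<in> I" for i
    proof -
      have "b i = (if i = k then s else 1) *\<^sub>R column i (Q s)"
        using s(1) by (auto simp: col abs_if split: if_splits)
      then show ?thesis
        using that by (metis imageI span_base span_scale)
    qed
    ultimately show ?thesis
      by (auto simp: span_eq)
  qed
  finally show ?thesis
    using that[of "Q s"] orth s b(3) by (auto simp: rotation_matrix_def)
qed

lemma fan_singleton_subspace:
  assumes "subspace L"
  shows "fan {L}"
  using fan_chambers[OF assms, of "{}"] arrangement_fan_eq_chambers[OF assms, of "{}"]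
  by (simp add: arrangement_fan_empty assms)

text \<open>
  Subspaces of equal dimension are rotations of the same coordinate subspace.
\<close>
lemma rotation_invariant_on_subspaces:
  fixes \<phi> :: "(real^'n) set set \<Rightarrow> 'g"
  assumes "rotation_invariant \<phi>"
  obtains g :: "nat \<Rightarrow> 'g" where "\<And>L. subspace L \<Longrightarrow> \<phi> {L} = g (dim L)"
proof -
  have ex: "\<exists>I :: 'n set. card I = k" if "k \<le> CARD('n)" for k
    using obtain_subset_with_card_n[of k "UNIV :: 'n set"] that by auto
  define E :: "nat \<Rightarrow> (real^'n) set"
    where "E k = span ((\<lambda>i. axis i 1) ` (SOME I. card I = k))" for k
  have "\<phi> {L} = \<phi> {E (dim L)}" if L: "subspace L" for L
  proof -
    have "card (SOME I :: 'n set. card I = dim L) = dim L"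
      using someI_ex[OF ex] dim_subset_UNIV_cart[of L] by blast
    from rotation_onto_subspace[OF L this]
    obtain Q where "rotation_matrix Q" "(*v) Q ` E (dim L) = L"
      unfolding E_def by metis
    moreover have "fan {E (dim L)}"
      unfolding E_def by (intro fan_singleton_subspace subspace_span)
    ultimately show ?thesis
      using assms unfolding rotation_invariant_def by (metis image_empty image_insert)
  qed
  then show ?thesis
    by (intro that[of "\<lambda>k. \<phi> {E k}"])
qed

section \<open>Both directions of the correspondence\<close>

text \<open>
  The invariant is determined by its values \<open>c k\<close> on \<open>k\<close>-singletons. The fan valuation has to take
  the values \<open>g k + g (k - 1)\<close> there, and solving \<open>g k + g (k - 1) = c k\<close> for \<open>g\<close> starting
  from \<open>g 0 = 0\<close> needs no division.
\<close>
lemma fan_valuation_extends_invariant: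
  fixes \<psi> :: "'a::euclidean_space set \<Rightarrow> 'a set set \<Rightarrow> 'g::ab_group_add"
  assumes \<psi>: "deletion_restriction_invariant \<psi>"
  shows "\<exists>\<phi>. fan_valuation \<phi> \<and> (\<forall>L A. arrangement L A \<longrightarrow> \<psi> L A = \<phi> (arrangement_fan L A))"
proof -
  have "\<exists>c. \<forall>L A. singleton_arrangement k L A \<longrightarrow> \<psi> L A = c" for k
    using \<psi> unfolding deletion_restriction_invariant_def by metis
  then obtain c where c: "\<And>k L A. singleton_arrangement k L A \<Longrightarrow> \<psi> L A = c k"
    by metis
  define g where "g = rec_nat 0 (\<lambda>k x. c (Suc k) - x)"
  have g: "g (Suc k) = c (Suc k) - g k" for k
    by (simp add: g_def)
  obtain \<phi> :: "'a set set \<Rightarrow> 'g"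
    where \<phi>: "fan_valuation \<phi>" "\<And>M. subspace M \<Longrightarrow> \<phi> {M} = g (dim M)"
    using fan_valuation_with_values_on_subspaces by blast
  have "\<psi> L A = \<phi> (arrangement_fan L A)" if "arrangement L A" for L A
    using that
  proof (induction rule: arrangement_induct)
    case (singleton k L A)
    then have "0 < k"
      by (auto simp: singleton_arrangement_def arrangement_def linear_hyperplane_def is_singleton_def)
    then have "g k + g (k - 1) = c k"
      using g[of "k - 1"] by simp
    then show ?case
      using fan_valuation_singleton[OF \<phi>(1) singleton \<phi>(2)] c[OF singleton] by simp
  next
    case (deletion_restriction L A H)
    then show ?case
      using \<psi> fan_valuation_arrangement_fan_insert[OF \<phi>(1)]
      unfolding deletion_restriction_invariant_def by metis
  qed
  then show ?thesis
    using \<phi>(1) by blast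
qed

theorem theorem1p1:
  shows "(\<forall>\<phi> :: (real^'n) set set \<Rightarrow> 'g::ab_group_add.
           fan_valuation \<phi> \<and> rotation_invariant \<phi> \<longrightarrow>
           (\<exists>g :: nat \<Rightarrow> 'g. \<forall>L A. arrangement L A \<longrightarrow>
              \<phi> (arrangement_fan L A) =
                (\<Sum>i = 0..CARD('n). nat_multiple (whitney_number i L A) (g i)))) \<and>
         (\<forall>\<psi> :: (real^'n) set \<Rightarrow> (real^'n) set set \<Rightarrow> 'g.
           deletion_restriction_invariant \<psi> \<longrightarrow>
           (\<exists>\<phi> :: (real^'n) set set \<Rightarrow> 'g. fan_valuation \<phi> \<and>
              (\<forall>L A. arrangement L A \<longrightarrow> \<psi> L A = \<phi> (arrangement_fan L A))))"
proof (intro conjI allI impI)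
  fix \<phi> :: "(real^'n) set set \<Rightarrow> 'g"
  assume \<phi>: "fan_valuation \<phi> \<and> rotation_invariant \<phi>"
  then obtain g :: "nat \<Rightarrow> 'g" where "\<And>L. subspace L \<Longrightarrow> \<phi> {L} = g (dim L)"
    using rotation_invariant_on_subspaces by blast
  then show "\<exists>g :: nat \<Rightarrow> 'g. \<forall>L A. arrangement L A \<longrightarrow> \<phi> (arrangement_fan L A) =
      (\<Sum>i = 0..CARD('n). nat_multiple (whitney_number i L A) (g i))"
    using fan_valuation_eq_whitney_sum[of \<phi> g] \<phi> by auto
next
  fix \<psi> :: "(real^'n) set \<Rightarrow> (real^'n) set set \<Rightarrow> 'g"
  assume "deletion_restriction_invariant \<psi>"
  then show "\<exists>\<phi> :: (real^'n) set set \<Rightarrow> 'g. fan_valuation \<phi> \<and>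
      (\<forall>L A. arrangement L A \<longrightarrow> \<psi> L A = \<phi> (arrangement_fan L A))"
    by (rule fan_valuation_extends_invariant)
qed

end
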